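(* Let $n=2$ and $H(y,p)=\tfrac12|p|^2-V(y)$, where $V\in C(\mathbb{T}^2)$, $\mathbb{T}^2=\mathbb{R}^2/\mathbb{Z}^2$, satisfies $0\le V\le1$, $V=1$ on $B_{1/8}(0)$ and $\mathrm{supp}(V)\subset B_{1/4}(0)$. Let $g\equiv0$ and $b\equiv1$. Set $x_0=(\tfrac12,\tfrac12)$, $D=B_{1/4}(x_0)\subset[0,1]^2$ and $$\Omega=\bigcup_{z\in\mathbb{Z}^2}\left(z+([0,1]^2\setminus\overline D)\right).$$ For $\varepsilon>0$ let $\Omega_\varepsilon=\varepsilon\Omega$ and let $u^\varepsilon$ be the viscosity solution of $$u^\varepsilon_t+H\left(\tfrac{x}{\varepsilon},Du^\varepsilon\right)=0\ \text{in }\Omega_\varepsilon\times(0,\infty),\quad u^\varepsilon=b\ \text{on }\partial\Omega_\varepsilon\times(0,\infty),\quad u^\varepsilon(\cdot,0)=g\ \text{on }\overline\Omega_\varepsilon,$$ and let $u$ be the viscosity solution of $$\max\{u-1,\ u_t+\overline H(Du)\}=0\ \text{in }\mathbb{R}^2\times(0,\infty),\qquad u(\cdot,0)=g\ \text{on }\mathbb{R}^2,$$ where $\overline H$ is the effective Hamiltonian of the state-constraint cell problem on $\overline\Omega$. Then for every $\varepsilon\in(0,1)$, $$u^\varepsilon(0,1)-u(0,1)\ge\frac{\varepsilon}{8}.$$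
   Context: $B_r(x)$ is the open ball of radius $r$ centered at $x$; $V$ is regarded as a $\mathbb{Z}^2$-periodic function on $\mathbb{R}^2$, the balls $B_{1/8}(0),B_{1/4}(0)$ being taken in $\mathbb{T}^2$. $\overline H(p)$ is the unique constant for which there is a $\mathbb{Z}^2$-periodic viscosity solution $v$ of $H(y,p+Dv)\le\overline H(p)$ in $\Omega$ (subsolution), $H(y,p+Dv)\ge\overline H(p)$ on $\overline\Omega$ (supersolution up to the boundary, tested relative to $\overline\Omega$). The Dirichlet condition is in the generalized viscosity sense: on $\partial\Omega_\varepsilon\times(0,\infty)$, with test functions touching relative to $\overline\Omega_\varepsilon\times(0,\infty)$, $\min\{u_t+H(\tfrac{x}{\varepsilon},Du),u-b\}\le0$ (subsolution) and $\max\{u_t+H(\tfrac{x}{\varepsilon},Du),u-b\}\ge0$ (supersolution). Both problems are taken to be well-posed, with unique (uniformly continuous) viscosity solutions. *)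

theory Defs
  imports "HOL-Analysis.Analysis"
begin

text \<open>\<^emph>\<open>Viscosity inequalities.\<close>
  \<open>touch_above S u z q\<close>: some test function \<open>\<phi>\<close>, of class \<open>C\<^sup>1\<close> on an open neighbourhood
  \<open>U\<close> of \<open>z\<close>, has gradient \<open>q\<close> at \<open>z\<close>, and \<open>u - \<phi>\<close> has a maximum over \<open>S \<inter> U\<close> at \<open>z\<close>;
  so \<open>u - \<phi>\<close> has a local maximum at \<open>z\<close> relative to \<open>S\<close>. Shrinking \<open>U\<close> yields all local
  maxima. On space-time, \<open>z = (x, t)\<close> and \<open>q = (D\<phi>, \<phi>\<^sub>t)\<close>.\<close>

definition C1_test :: "'a::euclidean_space set \<Rightarrow> ('a \<Rightarrow> real) \<Rightarrow> ('a \<Rightarrow> 'a) \<Rightarrow> bool" where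
  "C1_test U \<phi> G \<longleftrightarrow>
     (\<forall>w\<in>U. (\<phi> has_derivative (\<lambda>h. G w \<bullet> h)) (at w)) \<and> continuous_on U G"

definition touch_above :: "'a::euclidean_space set \<Rightarrow> ('a \<Rightarrow> real) \<Rightarrow> 'a \<Rightarrow> 'a \<Rightarrow> bool" where
  "touch_above S u z q \<longleftrightarrow>
     (\<exists>U \<phi> G. open U \<and> z \<in> U \<and> C1_test U \<phi> G \<and> G z = q \<and>
        (\<forall>w\<in>S \<inter> U. u w - \<phi> w \<le> u z - \<phi> z))"

definition touch_below :: "'a::euclidean_space set \<Rightarrow> ('a \<Rightarrow> real) \<Rightarrow> 'a \<Rightarrow> 'a \<Rightarrow> bool" where
  "touch_below S u z q \<longleftrightarrow>
     (\<exists>U \<phi> G. open U \<and> z \<in> U \<and> C1_test U \<phi> G \<and> G z = q \<and>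
        (\<forall>w\<in>S \<inter> U. u w - \<phi> w \<ge> u z - \<phi> z))"

text \<open>\<open>F z (u z) Du \<le> 0\<close> (resp. \<open>\<ge> 0\<close>) at the points of \<open>A\<close>, with test functions touching
  relative to \<open>S\<close>.\<close>

definition visc_sub ::
  "'a::euclidean_space set \<Rightarrow> 'a set \<Rightarrow> ('a \<Rightarrow> real \<Rightarrow> 'a \<Rightarrow> real) \<Rightarrow> ('a \<Rightarrow> real) \<Rightarrow> bool" where
  "visc_sub S A F u \<longleftrightarrow> (\<forall>z\<in>A. \<forall>q. touch_above S u z q \<longrightarrow> F z (u z) q \<le> 0)"

definition visc_super ::
  "'a::euclidean_space set \<Rightarrow> 'a set \<Rightarrow> ('a \<Rightarrow> real \<Rightarrow> 'a \<Rightarrow> real) \<Rightarrow> ('a \<Rightarrow> real) \<Rightarrow> bool" where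
  "visc_super S A F u \<longleftrightarrow> (\<forall>z\<in>A. \<forall>q. touch_below S u z q \<longrightarrow> F z (u z) q \<ge> 0)"

definition Zlat :: "(real^2) set" where
  "Zlat = {z. \<forall>i. z $ i \<in> \<int>}"

definition Z_periodic_on :: "(real^2) set \<Rightarrow> (real^2 \<Rightarrow> real) \<Rightarrow> bool" where
  "Z_periodic_on A f \<longleftrightarrow> (\<forall>y\<in>A. \<forall>z\<in>Zlat. f (y + z) = f y)"

text \<open>The lift to \<open>\<real>\<^sup>2\<close> of the ball of radius \<open>r\<close> about \<open>0\<close> in the torus.\<close>

definition torus_ball :: "real \<Rightarrow> (real^2) set" where
  "torus_ball r = (\<Union>z\<in>Zlat. ball z r)"

definition hole :: "(real^2) set" where
  "hole = ball (\<chi> i. 1/2) (1/4)"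

definition Omega :: "(real^2) set" where
  "Omega = (\<Union>z\<in>Zlat. (\<lambda>y. z + y) ` (cbox 0 (\<chi> i. 1) - closure hole))"

definition Omega_eps :: "real \<Rightarrow> (real^2) set" where
  "Omega_eps \<epsilon> = (\<lambda>y. \<epsilon> *\<^sub>R y) ` Omega"

definition Ham :: "(real^2 \<Rightarrow> real) \<Rightarrow> real^2 \<Rightarrow> real^2 \<Rightarrow> real" where
  "Ham V y p = (norm p)\<^sup>2 / 2 - V y"

definition cell_solvable ::
  "(real^2) set \<Rightarrow> (real^2 \<Rightarrow> real^2 \<Rightarrow> real) \<Rightarrow> real^2 \<Rightarrow> real \<Rightarrow> bool" where
  "cell_solvable W H p c \<longleftrightarrow>
     (\<exists>v. continuous_on (closure W) v \<and> Z_periodic_on (closure W) v \<and>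
        visc_sub W W (\<lambda>y r q. H y (p + q) - c) v \<and>
        visc_super (closure W) (closure W) (\<lambda>y r q. H y (p + q) - c) v)"

text \<open>\<open>Hb p\<close> is the unique constant for which the cell problem at \<open>p\<close> is solvable.\<close>

definition effective_Hamiltonian ::
  "(real^2) set \<Rightarrow> (real^2 \<Rightarrow> real^2 \<Rightarrow> real) \<Rightarrow> (real^2 \<Rightarrow> real) \<Rightarrow> bool" where
  "effective_Hamiltonian W H Hb \<longleftrightarrow> (\<forall>p c. cell_solvable W H p c \<longleftrightarrow> c = Hb p)"

text \<open>The Cauchy problem \<open>u\<^sub>t + H(x, Du) = 0\<close> in \<open>W \<times> (0,\<infinity>)\<close>, with \<open>u = b\<close> on the lateral
  boundary in the generalized viscosity sense and \<open>u = g\<close> initially. Only the values on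
  \<open>closure W \<times> [0,\<infinity>)\<close> matter.\<close>

definition dirichlet_solution ::
  "(real^2) set \<Rightarrow> (real^2 \<Rightarrow> real^2 \<Rightarrow> real) \<Rightarrow> (real^2 \<Rightarrow> real) \<Rightarrow> (real^2 \<Rightarrow> real) \<Rightarrow>
   ((real^2) \<times> real \<Rightarrow> real) \<Rightarrow> bool" where
  "dirichlet_solution W H b g u \<longleftrightarrow>
     uniformly_continuous_on (closure W \<times> {0..}) u \<and>
     visc_sub (W \<times> {0<..}) (W \<times> {0<..}) (\<lambda>(x, t) r (p, a). a + H x p) u \<and>
     visc_super (W \<times> {0<..}) (W \<times> {0<..}) (\<lambda>(x, t) r (p, a). a + H x p) u \<and>
     visc_sub (closure W \<times> {0<..}) (frontier W \<times> {0<..})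
       (\<lambda>(x, t) r (p, a). min (a + H x p) (r - b x)) u \<and>
     visc_super (closure W \<times> {0<..}) (frontier W \<times> {0<..})
       (\<lambda>(x, t) r (p, a). max (a + H x p) (r - b x)) u \<and>
     (\<forall>x\<in>closure W. u (x, 0) = g x)"

definition obstacle_solution ::
  "(real^2 \<Rightarrow> real) \<Rightarrow> (real^2 \<Rightarrow> real) \<Rightarrow> (real^2 \<Rightarrow> real) \<Rightarrow>
   ((real^2) \<times> real \<Rightarrow> real) \<Rightarrow> bool" where
  "obstacle_solution Hb b g u \<longleftrightarrow>
     uniformly_continuous_on (UNIV \<times> {0..}) u \<and>
     visc_sub (UNIV \<times> {0<..}) (UNIV \<times> {0<..}) (\<lambda>(x, t) r (p, a). max (r - b x) (a + Hb p)) u \<and>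
     visc_super (UNIV \<times> {0<..}) (UNIV \<times> {0<..}) (\<lambda>(x, t) r (p, a). max (r - b x) (a + Hb p)) u \<and>
     (\<forall>x. u (x, 0) = g x)"

end

theory Submission imports Defs begin

text \<open>Since \<open>V\<close> vanishes somewhere in the interior of \<open>Omega\<close>, the effective Hamiltonian is
  nonnegative; hence \<open>u\<close> is nonincreasing in time and \<open>u (0, 1) \<le> 0\<close>. For the lower bound on
  \<open>ueps\<close>, the functions \<open>- k |x - x\<^sub>0|\<^sup>2 - c t\<close> with small \<open>k\<close> and \<open>c\<close> first give \<open>ueps \<ge> 0\<close>. On the
  ball of radius \<open>R = \<epsilon>/8\<close>, where the running cost is at least \<open>1\<close>, a smoothed cone of slope at most
  \<open>5/4 < \<surd>2\<close>, multiplied by \<open>t\<close>, is a strict subsolution that vanishes on the sphere and equals \<open>R\<close>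
  at \<open>(0, 1)\<close>.\<close>

section \<open>Comparison with smooth strict subsolutions\<close>

text \<open>The penalty \<open>\<delta> t\<^sup>n\<close> with large \<open>n\<close> is small at \<open>t0\<close> and dominates at \<open>T\<close>, so that the
  minimum avoids the final time.\<close>

lemma time_localised_minimum:
  fixes f :: "'a::metric_space \<times> real \<Rightarrow> real"
  assumes K: "compact K" and f: "continuous_on (K \<times> {0..T}) f"
    and init: "\<And>x. x \<in> K \<Longrightarrow> 0 \<le> f (x, 0)"
    and neg: "x0 \<in> K" "0 < t0" "t0 < T" "f (x0, t0) < 0"
  obtains \<delta> n x t where "\<delta> > 0" "n > 0" "x \<in> K" "0 < t" "t < T" "f (x, t) < 0"
    "\<And>y s. y \<in> K \<Longrightarrow> s \<in> {0..T} \<Longrightarrow> f (x, t) + \<delta> * t ^ n \<le> f (y, s) + \<delta> * s ^ n"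
proof -
  have cK: "compact (K \<times> {0..T})" using K by (intro compact_Times) auto
  have "bounded (f ` (K \<times> {0..T}))"
    using compact_continuous_image[OF f cK] compact_imp_bounded by blast
  then obtain M where M: "\<And>z. z \<in> K \<times> {0..T} \<Longrightarrow> norm (f z) \<le> M"
    unfolding bounded_iff by blast
  \<comment> \<open>Half the depth of the negative value: a penalty equal to \<open>m\<close> at
    \<open>t0\<close> still leaves the value \<open>- m\<close> there.\<close>
  define m where "m = - f (x0, t0) / 2"
  have m: "m > 0" using neg by (simp add: m_def)
  have "1 < T / t0" using neg by simp
  \<comment> \<open>Since \<open>\<delta>\<close> makes the penalty equal to \<open>m\<close> at
    \<open>t0\<close>, its value at \<open>T\<close> is \<open>m * (T / t0) ^ n\<close>. This
    exceeds the bound \<open>M\<close> for large \<open>n\<close>, so the penalised function is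
    positive at time \<open>T\<close>.\<close>
  then obtain n0 where n0: "M / m < (T / t0) ^ n0" using real_arch_pow by blast
  \<comment> \<open>The successor ensures a positive exponent, so that the penalty has a strictly
    positive derivative at positive times.\<close>
  define n where "n = Suc n0"
  have n: "M / m < (T / t0) ^ n"
    using n0 power_increasing[of n0 n "T / t0"] \<open>1 < T / t0\<close> unfolding n_def by linarith
  define \<delta> where "\<delta> = m / t0 ^ n"
  have \<delta>: "\<delta> > 0" using m neg by (simp add: \<delta>_def)
  have "continuous_on (K \<times> {0..T}) (\<lambda>z. f z + \<delta> * snd z ^ n)"
    by (intro continuous_intros f)
  moreover have "K \<times> {0..T} \<noteq> {}" using neg by auto
  ultimately obtain z where z: "z \<in> K \<times> {0..T}"
    "\<And>w. w \<in> K \<times> {0..T} \<Longrightarrow> f z + \<delta> * snd z ^ n \<le> f w + \<delta> * snd w ^ n"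
    using continuous_attains_inf[OF cK] by blast
  obtain x t where zt: "z = (x, t)" by (cases z)
  have x: "x \<in> K" and t: "0 \<le> t" "t \<le> T" using z zt by auto
  have "f (x, t) + \<delta> * t ^ n \<le> f (x0, t0) + \<delta> * t0 ^ n"
    using z(2)[of "(x0, t0)"] neg zt by auto
  also have "\<dots> = - m" using neg by (simp add: m_def \<delta>_def)
  finally have le: "f (x, t) + \<delta> * t ^ n \<le> - m" .
  have "0 \<le> \<delta> * t ^ n" using \<delta> t by simp
  then have fneg: "f (x, t) < 0" using le m by linarith
  then have "t \<noteq> 0" using init[OF x] by auto
  moreover have "t \<noteq> T"
  proof
    assume "t = T"
    then have "\<delta> * t ^ n = m * (T / t0) ^ n" by (simp add: \<delta>_def power_divide)
    then have "\<delta> * t ^ n > M" using n m by (simp add: field_simps)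
    then show False using M[of "(x, t)"] x t le m by auto
  qed
  ultimately show ?thesis
    using that[of \<delta> n x t] \<delta> x t fneg z(2) zt n_def by auto
qed

text \<open>All space-time test functions below have this form: paraboloids and cones in space,
  multiplied by a function of time and shifted by a time penalty. One gradient computation serves
  them all.\<close>

lemma C1_test_separable:
  fixes B :: "'a::euclidean_space \<Rightarrow> real"
  assumes B: "\<And>x. (B has_derivative (\<lambda>h. b x \<bullet> h)) (at x)" and b: "continuous_on UNIV b"
    and P: "\<And>t. (P has_field_derivative P' t) (at t)" and P': "continuous_on UNIV P'"
    and Q: "\<And>t. (Q has_field_derivative Q' t) (at t)" and Q': "continuous_on UNIV Q'"
  shows "C1_test U (\<lambda>(x, t). P t * B x + Q t)
           (\<lambda>(x, t). (P t *\<^sub>R b x, P' t * B x + Q' t))"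
  unfolding C1_test_def
proof (intro conjI ballI)
  fix w :: "'a \<times> real"
  have dB: "((\<lambda>z. B (fst z)) has_derivative (\<lambda>h. b (fst w) \<bullet> fst h)) (at w)"
    by (rule has_derivative_compose[OF has_derivative_fst[OF has_derivative_ident] B])
  have dP: "((\<lambda>z. P (snd z)) has_derivative (\<lambda>h. P' (snd w) * snd h)) (at w)"
    by (rule has_derivative_compose[OF has_derivative_snd[OF has_derivative_ident]
          P[unfolded has_field_derivative_def]])
  have dQ: "((\<lambda>z. Q (snd z)) has_derivative (\<lambda>h. Q' (snd w) * snd h)) (at w)"
    by (rule has_derivative_compose[OF has_derivative_snd[OF has_derivative_ident]
          Q[unfolded has_field_derivative_def]])
  show "((\<lambda>(x, t). P t * B x + Q t) has_derivative
      (\<lambda>h. (case w of (x, t) \<Rightarrow> (P t *\<^sub>R b x, P' t * B x + Q' t)) \<bullet> h)) (at w)"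
    unfolding case_prod_beta
    by (rule has_derivative_eq_rhs[OF has_derivative_add[OF has_derivative_mult[OF dP dB] dQ]])
      (auto simp: fun_eq_iff inner_prod_def algebra_simps)
next
  have cB: "continuous_on UNIV B"
    by (rule has_derivative_continuous_on) (rule B)
  have cP: "continuous_on UNIV P"
    by (rule DERIV_continuous_on) (rule P)
  show "continuous_on U (\<lambda>(x, t). (P t *\<^sub>R b x, P' t * B x + Q' t))"
    unfolding case_prod_beta
    by (intro continuous_intros continuous_on_compose2[OF cB] continuous_on_compose2[OF cP]
        continuous_on_compose2[OF b] continuous_on_compose2[OF P'] continuous_on_compose2[OF Q'])
      auto
qed

lemma has_derivative_norm_square_diff:
  fixes x :: "'a::euclidean_space"
  shows "((\<lambda>x. k * (norm (x - x0))\<^sup>2) has_derivative (\<lambda>h. ((2 * k) *\<^sub>R (x - x0)) \<bullet> h)) (at x)"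
  unfolding power2_norm_eq_inner
  by (auto intro!: derivative_eq_intros simp: inner_commute algebra_simps)

text \<open>On the lateral boundary a strict smooth subsolution can only touch from below where
  \<open>u \<ge> 1\<close>, which is why \<open>w \<le> 1\<close> is required.\<close>

lemma dirichlet_comparison:
  fixes u :: "(real^2) \<times> real \<Rightarrow> real" and B P Q
  defines "w \<equiv> \<lambda>(x, t). P t * B x + Q t"
  assumes sol: "dirichlet_solution W H (\<lambda>_. 1) (\<lambda>_. 0) u"
    and B: "\<And>x. (B has_derivative (\<lambda>h. b x \<bullet> h)) (at x)" and b: "continuous_on UNIV b"
    and P: "\<And>t. (P has_field_derivative P' t) (at t)" and P': "continuous_on UNIV P'"
    and Q: "\<And>t. (Q has_field_derivative Q' t) (at t)" and Q': "continuous_on UNIV Q'"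
    and init: "\<And>x. x \<in> closure W \<Longrightarrow> x \<in> cball x0 R \<Longrightarrow> w (x, 0) \<le> 0"
    and lateral: "\<And>x t. x \<in> closure W \<Longrightarrow> dist x0 x = R \<Longrightarrow> 0 < t \<Longrightarrow> t < T \<Longrightarrow> w (x, t) \<le> u (x, t)"
    and le1: "\<And>x t. x \<in> closure W \<Longrightarrow> x \<in> ball x0 R \<Longrightarrow> 0 < t \<Longrightarrow> t < T \<Longrightarrow> w (x, t) \<le> 1"
    and strict: "\<And>x t. x \<in> closure W \<Longrightarrow> x \<in> ball x0 R \<Longrightarrow> 0 < t \<Longrightarrow> t < T \<Longrightarrow>
                   P' t * B x + Q' t + H x (P t *\<^sub>R b x) < 0"
    and pt: "y \<in> closure W" "y \<in> cball x0 R" "0 < s" "s < T"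
  shows "w (y, s) \<le> u (y, s)"
proof (rule ccontr)
  assume "\<not> w (y, s) \<le> u (y, s)"
  then have neg: "u (y, s) - w (y, s) < 0" by simp
  define K where "K = closure W \<inter> cball x0 R"
  have K: "compact K" unfolding K_def by (simp add: closed_Int_compact)
  have cu: "continuous_on (closure W \<times> {0..}) u"
    using sol uniformly_continuous_imp_continuous unfolding dirichlet_solution_def by blast
  have "(w has_derivative (\<lambda>h. (case z of (x, t) \<Rightarrow> (P t *\<^sub>R b x, P' t * B x + Q' t)) \<bullet> h)) (at z)"
    for z
    using C1_test_separable[OF B b P P' Q Q', of UNIV] unfolding C1_test_def w_def
    by (rule conjunct1[THEN bspec]) (rule UNIV_I)
  then have "continuous_on (K \<times> {0..T}) w"
    by (intro continuous_at_imp_continuous_on ballI has_derivative_continuous)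
  then have "continuous_on (K \<times> {0..T}) (\<lambda>z. u z - w z)"
    by (intro continuous_intros continuous_on_subset[OF cu]) (auto simp: K_def)
  moreover have "\<And>x. x \<in> K \<Longrightarrow> 0 \<le> u (x, 0) - w (x, 0)"
    using sol init unfolding dirichlet_solution_def K_def by fastforce
  moreover have "y \<in> K" using pt by (simp add: K_def)
  ultimately obtain \<delta> n x t where \<delta>: "\<delta> > 0" "n > 0" and x: "x \<in> K" and t: "0 < t" "t < T"
    and uw: "u (x, t) - w (x, t) < 0"
    and min: "\<And>y s. y \<in> K \<Longrightarrow> s \<in> {0..T} \<Longrightarrow>
      u (x, t) - w (x, t) + \<delta> * t ^ n \<le> u (y, s) - w (y, s) + \<delta> * s ^ n"
    using time_localised_minimum[OF K, of T "\<lambda>z. u z - w z" y s] pt neg by blast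
  \<comment> \<open>The penalty depends on time alone and is absorbed into the additive term, so the
    test function stays separable.\<close>
  define Q1 where "Q1 = (\<lambda>t. Q t - \<delta> * t ^ n)"
  define Q1' where "Q1' = (\<lambda>t. Q' t - \<delta> * (real n * t ^ (n - 1)))"
  have Q1: "\<And>t. (Q1 has_field_derivative Q1' t) (at t)"
    unfolding Q1_def Q1'_def by (auto intro!: derivative_eq_intros Q)
  have Q1': "continuous_on UNIV Q1'"
    unfolding Q1'_def by (intro continuous_intros Q')
  define U where "U = ball x0 R \<times> {0<..<T}"
  have xW: "x \<in> closure W" and "x \<in> cball x0 R" using x by (auto simp: K_def)
  moreover have "dist x0 x \<noteq> R" using lateral[OF xW _ t] uw by auto
  ultimately have xb: "x \<in> ball x0 R" by auto
  define q where "q = P t *\<^sub>R b x"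
  define a where "a = P' t * B x + Q1' t"
  have touch: "touch_below (closure W \<times> {0<..}) u (x, t) (q, a)"
    unfolding touch_below_def
  proof (intro exI conjI)
    show "open U" unfolding U_def by (intro open_Times) auto
    show "(x, t) \<in> U" using xb t by (auto simp: U_def)
    show "C1_test U (\<lambda>(x, t). P t * B x + Q1 t) (\<lambda>(x, t). (P t *\<^sub>R b x, P' t * B x + Q1' t))"
      by (rule C1_test_separable[OF B b P P' Q1 Q1'])
    show "(case (x, t) of (x, t) \<Rightarrow> (P t *\<^sub>R b x, P' t * B x + Q1' t)) = (q, a)"
      by (simp add: q_def a_def)
    show "\<forall>z\<in>closure W \<times> {0<..} \<inter> U.
        u (x, t) - (case (x, t) of (x, t) \<Rightarrow> P t * B x + Q1 t)
          \<le> u z - (case z of (x, t) \<Rightarrow> P t * B x + Q1 t)"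
    proof
      fix z assume "z \<in> closure W \<times> {0<..} \<inter> U"
      then obtain y s where "z = (y, s)" "y \<in> K" "s \<in> {0..T}"
        by (auto simp: U_def K_def)
      then show "u (x, t) - (case (x, t) of (x, t) \<Rightarrow> P t * B x + Q1 t)
          \<le> u z - (case z of (x, t) \<Rightarrow> P t * B x + Q1 t)"
        using min[of y s] by (simp add: w_def Q1_def)
    qed
  qed
  \<comment> \<open>On the smaller set fewer points compete, so the same test function also serves
    the condition in \<open>W\<close>.\<close>
  have touchW: "touch_below (W \<times> {0<..}) u (x, t) (q, a)"
    using touch closure_subset[of W] unfolding touch_below_def by fast
  \<comment> \<open>The penalty only lowers the time derivative of the test function, so strictness
    survives.\<close>
  have "Q1' t \<le> Q' t" using \<delta> t by (simp add: Q1'_def)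
  then have lt: "a + H x q < 0" using strict[OF xW xb t] by (simp add: a_def q_def)
  show False
  proof (cases "x \<in> frontier W")
    case True
    have "max (a + H x q) (u (x, t) - 1) \<ge> 0"
      using sol touch True t unfolding dirichlet_solution_def visc_super_def by fastforce
    then show False using lt uw le1[OF xW xb t] by auto
  next
    case False
    then have "x \<in> W" using xW interior_subset[of W] by (auto simp: frontier_def)
    then have "a + H x q \<ge> 0"
      using sol touchW t unfolding dirichlet_solution_def visc_super_def by fastforce
    then show False using lt by simp
  qed
qed

section \<open>Bounds on finite time intervals and the lower bound for the Dirichlet problem\<close>

text \<open>The modulus of continuity is uniform in space, so each time step of length
  \<open>d / 2\<close> changes \<open>u\<close> by less than 1, and finitely many steps reach
  \<open>T\<close>. The bound fixes the size of the barriers, although \<open>A\<close> may be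
  unbounded.\<close>

lemma uniformly_continuous_time_bounded:
  fixes u :: "'a::metric_space \<times> real \<Rightarrow> real"
  assumes u: "uniformly_continuous_on (A \<times> {0..}) u" and init: "\<And>x. x \<in> A \<Longrightarrow> u (x, 0) = 0"
  obtains M where "\<And>x t. x \<in> A \<Longrightarrow> 0 \<le> t \<Longrightarrow> t \<le> T \<Longrightarrow> \<bar>u (x, t)\<bar> \<le> M"
proof -
  obtain d where d: "d > 0"
    "\<And>z z'. z \<in> A \<times> {0..} \<Longrightarrow> z' \<in> A \<times> {0..} \<Longrightarrow> dist z' z < d \<Longrightarrow> dist (u z') (u z) < 1"
    using u unfolding uniformly_continuous_on_def by (metis zero_less_one)
  have *: "\<bar>u (x, t)\<bar> \<le> real n" if "x \<in> A" "0 \<le> t" "t \<le> real n * (d / 2)" for x t n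
    using that
  proof (induction n arbitrary: t)
    case 0
    then show ?case using init by auto
  next
    case (Suc n)
    \<comment> \<open>One step back in time, cut off at 0 to remain in the domain.\<close>
    define s where "s = max 0 (t - d / 2)"
    have "0 \<le> real n * (d / 2)" "t \<le> real n * (d / 2) + d / 2"
      using Suc.prems d(1) by (auto simp: algebra_simps)
    then have s: "0 \<le> s" "s \<le> real n * (d / 2)" "\<bar>s - t\<bar> < d"
      using Suc.prems d(1) unfolding s_def by linarith+
    have "dist (x, s) (x, t) < d" using s by (simp add: dist_prod_def dist_real_def)
    then have "dist (u (x, s)) (u (x, t)) < 1" using d(2) Suc.prems s by auto
    then show ?case using Suc.IH[OF Suc.prems(1) s(1,2)] by (auto simp: dist_real_def)
  qed
  obtain n where "T / (d / 2) < real n" using reals_Archimedean2 by blast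
  then have "T \<le> real n * (d / 2)" using d(1) by (simp add: field_simps)
  then show ?thesis using * that[of "real n"] by force
qed

text \<open>A paraboloid can fall to \<open>- M\<close> on a large sphere and yet have a gradient so
  small that a slow decay in time makes it a strict subsolution. The decay rate \<open>c\<close>
  then tends to 0.\<close>

lemma dirichlet_solution_nonneg:
  assumes sol: "dirichlet_solution W H (\<lambda>_. 1) (\<lambda>_. 0) u"
    and H: "\<And>x p. H x p \<le> (norm p)\<^sup>2 / 2"
    and x0: "x0 \<in> closure W" and t0: "0 < t0"
  shows "0 \<le> u (x0, t0)"
proof -
  define T where "T = t0 + 1"
  have "uniformly_continuous_on (closure W \<times> {0..}) u" "\<And>x. x \<in> closure W \<Longrightarrow> u (x, 0) = 0"
    using sol unfolding dirichlet_solution_def by auto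
  then obtain M0 where M0: "\<And>x t. x \<in> closure W \<Longrightarrow> 0 \<le> t \<Longrightarrow> t \<le> T \<Longrightarrow> \<bar>u (x, t)\<bar> \<le> M0"
    using uniformly_continuous_time_bounded[of "closure W" u T] by metis
  \<comment> \<open>The added 1 makes \<open>M\<close> strictly positive, hence also
    \<open>R\<close> and \<open>k\<close>.\<close>
  define M where "M = \<bar>M0\<bar> + 1"
  have M: "\<And>x t. x \<in> closure W \<Longrightarrow> 0 \<le> t \<Longrightarrow> t \<le> T \<Longrightarrow> \<bar>u (x, t)\<bar> \<le> M" "M > 0"
    using M0 by (force simp: M_def)+
  have *: "- (c * t0) \<le> u (x0, t0)" if c: "c > 0" for c
  proof -
    \<comment> \<open>With \<open>k = M / R\<^sup>2\<close> the paraboloid equals \<open>- M\<close>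
      on the sphere. Its gradient is at most \<open>2 * k * R\<close> in norm, so the Hamiltonian is
      at most \<open>2 * (k * R)\<^sup>2 = c / 2\<close>.\<close>
    define R where "R = 2 * M / sqrt c"
    have R: "R > 0" using M c by (simp add: R_def)
    have R2: "R\<^sup>2 = 4 * M\<^sup>2 / c" using c by (simp add: R_def power_divide power_mult_distrib)
    define k where "k = M / R\<^sup>2"
    have k: "k > 0" using M R by (simp add: k_def)
    have kR: "2 * (k * R)\<^sup>2 < c"
    proof -
      have "2 * (k * R)\<^sup>2 = 2 * M\<^sup>2 / R\<^sup>2" using R by (simp add: k_def power2_eq_square)
      also have "\<dots> = c / 2" using M(2) c unfolding R2 by (simp add: power2_eq_square)
      finally show ?thesis using c by simp
    qed
    have "(case (x0, t0) of (x, t) \<Rightarrow> 1 * (- k * (norm (x - x0))\<^sup>2) + - (c * t)) \<le> u (x0, t0)"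
    proof (rule dirichlet_comparison[OF sol, where R = R and T = T and ?x0.0 = x0
          and P' = "\<lambda>_. 0" and Q' = "\<lambda>_. - c" and b = "\<lambda>x. (2 * - k) *\<^sub>R (x - x0)"])
      show "((\<lambda>x. - k * (norm (x - x0))\<^sup>2) has_derivative
          (\<lambda>h. ((2 * - k) *\<^sub>R (x - x0)) \<bullet> h)) (at x)" for x
        by (rule has_derivative_norm_square_diff)
      show "((\<lambda>t. - (c * t)) has_field_derivative - c) (at t)" for t
        by (auto intro!: derivative_eq_intros)
      show "(case (x, t) of (x, t) \<Rightarrow> 1 * (- k * (norm (x - x0))\<^sup>2) + - (c * t)) \<le> u (x, t)"
        if "x \<in> closure W" "dist x0 x = R" "0 < t" "t < T" for x t
      proof -
        have "norm (x - x0) = R" using that by (simp add: dist_norm norm_minus_commute)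
        then have "k * (norm (x - x0))\<^sup>2 = M" using R by (simp add: k_def)
        moreover have "0 \<le> c * t" using c that by simp
        ultimately show ?thesis using M(1)[of x t] that by auto
      qed
      show "(case (x, t) of (x, t) \<Rightarrow> 1 * (- k * (norm (x - x0))\<^sup>2) + - (c * t)) \<le> 1"
        if "0 < t" for x t
      proof -
        have "0 \<le> c * t" "0 \<le> k * (norm (x - x0))\<^sup>2" using c k that by auto
        then show ?thesis by auto
      qed
      show "0 * (- k * (norm (x - x0))\<^sup>2) + - c + H x (1 *\<^sub>R ((2 * - k) *\<^sub>R (x - x0))) < 0"
        if "x \<in> ball x0 R" for x
      proof -
        have "norm (x - x0) \<le> R" using that by (simp add: dist_norm norm_minus_commute)
        then have "(k * norm (x - x0))\<^sup>2 \<le> (k * R)\<^sup>2"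
          using k by (intro power_mono mult_left_mono) auto
        moreover have "H x ((2 * - k) *\<^sub>R (x - x0)) \<le> 2 * (k * norm (x - x0))\<^sup>2"
          using H[of x "(2 * - k) *\<^sub>R (x - x0)"] by (simp add: power_mult_distrib)
        ultimately show ?thesis using kR by auto
      qed
    qed (use R k x0 t0 in \<open>auto intro!: continuous_intros simp: T_def\<close>)
    then show ?thesis by simp
  qed
  show ?thesis
  proof (rule ccontr)
    assume "\<not> 0 \<le> u (x0, t0)"
    \<comment> \<open>For this rate the lower bound is half of the negative number
      \<open>u (x0, t0)\<close>, which lies above that number.\<close>
    then show False using *[of "- u (x0, t0) / (2 * t0)"] t0 by (simp add: field_simps)
  qed
qed

lemma dirichlet_solution_lower_bound:
  assumes sol: "dirichlet_solution W H (\<lambda>_. 1) (\<lambda>_. 0) u"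
    and H: "\<And>x p. H x p \<le> (norm p)\<^sup>2 / 2"
    and H1: "\<And>x p. x \<in> ball x0 R \<Longrightarrow> H x p \<le> (norm p)\<^sup>2 / 2 - 1"
    and x0: "x0 \<in> closure W" and R: "0 < R" "R \<le> 1/8"
  shows "R \<le> u (x0, 1)"
proof -
  \<comment> \<open>The smoothing parameter comes from the Pythagorean triple \<open>9\<^sup>2 + 40\<^sup>2 = 41\<^sup>2\<close>: it makes \<open>B\<close>
    vanish on the sphere and equal \<open>R\<close> at the centre.\<close>
  define S where "S = (\<lambda>x. sqrt ((x - x0) \<bullet> (x - x0) + (9 / 40 * R)\<^sup>2))"
  define B where "B = (\<lambda>x. 5/4 * (41/40 * R - S x))"
  define b where "b = (\<lambda>x. (- (5/4) / S x) *\<^sub>R (x - x0))"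
  have pos: "(x - x0) \<bullet> (x - x0) + (9 / 40 * R)\<^sup>2 > 0" for x
    using R by (intro add_nonneg_pos) auto
  have S: "S x > 0" "norm (x - x0) \<le> S x" "9 / 40 * R \<le> S x" for x
    using pos[of x] unfolding S_def
    by (auto simp flip: power2_norm_eq_inner intro!: real_le_rsqrt)
  have Sc: "S x0 = 9/40 * R" using R by (simp add: S_def)
  \<comment> \<open>The slope fits because 5/4 * (41/40 - 9/40) = 1.\<close>
  have B_le: "B x \<le> R" for x using S(3)[of x] by (simp add: B_def)
  have b_le: "norm (b x) \<le> 5/4" for x
    using S(1,2)[of x] unfolding b_def norm_scaleR by (simp add: divide_simps)
  have "(case (x0, 1) of (x, t) \<Rightarrow> t * B x + 0) \<le> u (x0, 1)"
  \<comment> \<open>The final time must exceed 1, where the bound is read off, but stay close to 1,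
    because the slope of the barrier grows with \<open>t\<close>.\<close>
  proof (rule dirichlet_comparison[OF sol, where R = R and T = "21/20" and ?x0.0 = x0
        and P' = "\<lambda>_. 1" and Q' = "\<lambda>_. 0" and b = b])
    show "(B has_derivative (\<lambda>h. b x \<bullet> h)) (at x)" for x
    proof -
      have "((\<lambda>x. (x - x0) \<bullet> (x - x0) + (9 / 40 * R)\<^sup>2) has_derivative (\<lambda>h. 2 * ((x - x0) \<bullet> h))) (at x)"
        by (auto intro!: derivative_eq_intros simp: inner_commute)
      note sq = has_derivative_real_sqrt[OF pos this]
      have half: "2 * a * (inverse s / 2) = a / s" for a s :: real
        by (cases "s = 0") (simp_all add: field_simps)
      have "(S has_derivative (\<lambda>h. (x - x0) \<bullet> h / S x)) (at x)"
        using sq unfolding S_def half .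
      from has_derivative_mult_right[OF has_derivative_diff[OF has_derivative_const this]]
      show ?thesis
        unfolding B_def b_def inner_scaleR_left by (rule has_derivative_eq_rhs) auto
    qed
    show "continuous_on UNIV b"
      unfolding b_def S_def using pos by (intro continuous_intros) (auto simp: less_imp_neq[symmetric])
    \<comment> \<open>The barrier vanishes on the sphere, so the nonnegativity of \<open>u\<close>
      suffices there.\<close>
    show "(case (x, t) of (x, t) \<Rightarrow> t * B x + 0) \<le> u (x, t)"
      if "x \<in> closure W" "dist x0 x = R" "0 < t" for x t
    proof -
      have "(norm (x - x0))\<^sup>2 = R\<^sup>2" using that by (simp add: dist_norm norm_minus_commute)
      then have "S x = sqrt ((41/40 * R)\<^sup>2)"
        unfolding S_def power2_norm_eq_inner by (simp add: power2_eq_square)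
      then have "B x = 0" using R by (simp add: B_def)
      then show ?thesis using dirichlet_solution_nonneg[OF sol H] that by simp
    qed
    show "(case (x, t) of (x, t) \<Rightarrow> t * B x + 0) \<le> 1" if t: "0 < t" "t < 21/20" for x t
    proof -
      have "t * B x \<le> t * R" using B_le[of x] t by (intro mult_left_mono) auto
      also have "\<dots> \<le> 21/20 * (1/8)" using R t by (intro mult_mono) auto
      finally show ?thesis by simp
    qed
    show "1 * B x + 0 + H x (t *\<^sub>R b x) < 0"
      if x: "x \<in> ball x0 R" and t: "0 < t" "t < 21/20" for x t
    proof -
      \<comment> \<open>The worst case is 1/8 + (21/16)^2 / 2 - 1 = -7/512, which is just
        negative.\<close>
      have "norm (t *\<^sub>R b x) \<le> 21/20 * (5/4)"
        unfolding norm_scaleR using b_le[of x] t by (intro mult_mono) auto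
      then have "(norm (t *\<^sub>R b x))\<^sup>2 \<le> (21/20 * (5/4))\<^sup>2" by (intro power_mono) auto
      then show ?thesis
        using H1[OF x, of "t *\<^sub>R b x"] B_le[of x] R by (simp add: power2_eq_square)
    qed
  qed (use R x0 in auto)
  then show ?thesis by (simp add: B_def Sc)
qed

section \<open>The upper bound for the obstacle problem\<close>

text \<open>A subsolution of the \<open>max\<close> equation satisfies the evolution inequality
  whatever the obstacle is. As \<open>Hb\<close> is nonnegative, no test function with positive time
  derivative can touch from above, whereas a positive value of \<open>u\<close> would produce
  one.\<close>

lemma obstacle_solution_nonpos:
  assumes sol: "obstacle_solution Hb b (\<lambda>_. 0) u" and Hb: "\<And>p. 0 \<le> Hb p" and t0: "0 < t0"
  shows "u (x0, t0) \<le> 0"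
proof (rule ccontr)
  assume "\<not> u (x0, t0) \<le> 0"
  define T where "T = t0 + 1"
  have cu: "continuous_on (UNIV \<times> {0..}) u"
    using sol uniformly_continuous_imp_continuous unfolding obstacle_solution_def by blast
  have "uniformly_continuous_on (UNIV \<times> {0..}) u" "\<And>x. u (x, 0) = 0"
    using sol unfolding obstacle_solution_def by auto
  then obtain M where M: "\<And>x t. 0 \<le> t \<Longrightarrow> t \<le> T \<Longrightarrow> \<bar>u (x, t)\<bar> \<le> M"
    using uniformly_continuous_time_bounded[of UNIV u T] by (metis UNIV_I)
  have M0: "0 \<le> M" using M[of 0 x0] t0 by (auto simp: T_def)
  \<comment> \<open>The coefficient \<open>M\<close> makes \<open>f\<close> nonnegative on the unit
    sphere about \<open>x0\<close>, so a negative minimum lies inside.\<close>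
  define f where "f = (\<lambda>z. M * (norm (fst z - x0))\<^sup>2 - u z)"
  have cf: "continuous_on (cball x0 1 \<times> {0..T}) f"
    unfolding f_def by (intro continuous_intros continuous_on_subset[OF cu]) auto
  have f0: "0 \<le> f (x, 0)" for x
    using M0 sol by (simp add: f_def obstacle_solution_def)
  have x0: "x0 \<in> cball x0 1" and t0T: "t0 < T" by (simp_all add: T_def)
  have f_x0: "f (x0, t0) < 0" using \<open>\<not> u (x0, t0) \<le> 0\<close> by (simp add: f_def)
  obtain \<delta> n x t where \<delta>: "\<delta> > 0" "n > 0" and x: "x \<in> cball x0 1"
    and t: "0 < t" "t < T" and fneg: "f (x, t) < 0"
    and min: "\<And>y s. y \<in> cball x0 1 \<Longrightarrow> s \<in> {0..T} \<Longrightarrow>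
      f (x, t) + \<delta> * t ^ n \<le> f (y, s) + \<delta> * s ^ n"
    using time_localised_minimum[OF compact_cball cf f0 x0 t0 t0T f_x0] by blast
  define Q' where "Q' = (\<lambda>t. \<delta> * (real n * t ^ (n - 1)))"
  have Q: "((\<lambda>t. \<delta> * t ^ n) has_field_derivative Q' t) (at t)" for t
    unfolding Q'_def by (auto intro!: derivative_eq_intros)
  have Q': "continuous_on UNIV Q'" unfolding Q'_def by (intro continuous_intros)
  have "dist x0 x \<noteq> 1"
  proof
    assume "dist x0 x = 1"
    then have "norm (x - x0) = 1" by (simp add: dist_norm norm_minus_commute)
    then show False using fneg M[of t x] t by (simp add: f_def)
  qed
  then have xb: "x \<in> ball x0 1" using x by auto
  \<comment> \<open>The factors 1 and 0 match the separable form with a constant time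
    factor.\<close>
  define G where "G = (\<lambda>(x, t). (1 *\<^sub>R ((2 * M) *\<^sub>R (x - x0)), 0 * (M * (norm (x - x0))\<^sup>2) + Q' t))"
  have "touch_above (UNIV \<times> {0<..}) u (x, t) (G (x, t))"
    unfolding touch_above_def
  proof (intro exI conjI)
    show "open (ball x0 1 \<times> {0<..<T})" by (intro open_Times) auto
    show "(x, t) \<in> ball x0 1 \<times> {0<..<T}" using xb t by auto
    show "C1_test (ball x0 1 \<times> {0<..<T})
        (\<lambda>(x, t). 1 * (M * (norm (x - x0))\<^sup>2) + \<delta> * t ^ n) G"
      unfolding G_def
      by (rule C1_test_separable[OF has_derivative_norm_square_diff _ _ _ Q Q'])
        (auto intro!: continuous_intros)
    show "\<forall>z\<in>UNIV \<times> {0<..} \<inter> ball x0 1 \<times> {0<..<T}.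
        u z - (case z of (x, t) \<Rightarrow> 1 * (M * (norm (x - x0))\<^sup>2) + \<delta> * t ^ n)
        \<le> u (x, t) - (case (x, t) of (x, t) \<Rightarrow> 1 * (M * (norm (x - x0))\<^sup>2) + \<delta> * t ^ n)"
    proof
      fix z assume "z \<in> UNIV \<times> {0<..} \<inter> ball x0 1 \<times> {0<..<T}"
      then obtain y s where "z = (y, s)" "y \<in> cball x0 1" "s \<in> {0..T}" by auto
      then show "u z - (case z of (x, t) \<Rightarrow> 1 * (M * (norm (x - x0))\<^sup>2) + \<delta> * t ^ n)
        \<le> u (x, t) - (case (x, t) of (x, t) \<Rightarrow> 1 * (M * (norm (x - x0))\<^sup>2) + \<delta> * t ^ n)"
        using min[of y s] by (simp add: f_def)
    qed
  qed simp
  then have "Q' t + Hb (fst (G (x, t))) \<le> 0"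
    using sol t unfolding obstacle_solution_def visc_sub_def G_def by fastforce
  moreover have "Q' t > 0" using \<delta> t by (simp add: Q'_def)
  ultimately show False using Hb[of "fst (G (x, t))"] by simp
qed

section \<open>Nonnegativity of the effective Hamiltonian\<close>

text \<open>Subtracting a steep paraboloid forces the maximum into the interior. A merely continuous
  subsolution can thus be tested somewhere in every ball; the slope \<open>q\<close> is not
  controlled.\<close>

lemma touch_above_in_ball:
  fixes v :: "'a::euclidean_space \<Rightarrow> real"
  assumes v: "continuous_on (cball y0 r) v" and r: "r > 0"
  obtains z q where "z \<in> ball y0 r" "touch_above S v z q"
proof -
  have "bounded (v ` cball y0 r)"
    using compact_continuous_image[OF v compact_cball] compact_imp_bounded by blast
  then obtain M where M: "\<And>z. z \<in> cball y0 r \<Longrightarrow> norm (v z) \<le> M"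
    unfolding bounded_iff by blast
  \<comment> \<open>On the sphere the penalised value is at most \<open>M - (2 * M + 1)\<close>,
    which is below \<open>- M\<close> and hence below the value at the centre.\<close>
  define k where "k = (2 * M + 1) / r\<^sup>2"
  have "continuous_on (cball y0 r) (\<lambda>y. v y - k * (norm (y - y0))\<^sup>2)"
    by (intro continuous_intros v)
  then obtain z where z: "z \<in> cball y0 r"
    "\<And>y. y \<in> cball y0 r \<Longrightarrow> v y - k * (norm (y - y0))\<^sup>2 \<le> v z - k * (norm (z - y0))\<^sup>2"
    using continuous_attains_sup[OF compact_cball, of y0 r] r by fastforce
  have "dist y0 z \<noteq> r"
  proof
    assume "dist y0 z = r"
    then have "k * (norm (z - y0))\<^sup>2 = 2 * M + 1"
      using r by (simp add: k_def dist_norm norm_minus_commute)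
    then show False using z(2)[of y0] M[of y0] M[OF z(1)] r by auto
  qed
  then have zb: "z \<in> ball y0 r" using z(1) by auto
  have "C1_test (ball y0 r) (\<lambda>y. k * (norm (y - y0))\<^sup>2) (\<lambda>y. (2 * k) *\<^sub>R (y - y0))"
    unfolding C1_test_def
    by (intro conjI ballI has_derivative_norm_square_diff continuous_intros)
  then have "touch_above S v z ((2 * k) *\<^sub>R (z - y0))"
    unfolding touch_above_def using zb z(2)
    by (intro exI[of _ "ball y0 r"] exI[of _ "\<lambda>y. k * (norm (y - y0))\<^sup>2"]
        exI[of _ "\<lambda>y. (2 * k) *\<^sub>R (y - y0)"]) auto
  then show ?thesis using that zb by blast
qed

lemma zero_in_Zlat: "0 \<in> Zlat"
  by (simp add: Zlat_def)

lemma cbox_minus_hole_subset_Omega: "cbox 0 (\<chi> i. 1) - closure hole \<subseteq> Omega"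
  unfolding Omega_def using zero_in_Zlat by force

lemma zero_in_Omega_eps: "0 \<in> Omega_eps \<epsilon>"
proof -
  have "\<bar>(0 - (\<chi> i. 1/2) :: real^2) $ 1\<bar> \<le> dist 0 ((\<chi> i. 1/2) :: real^2)"
    unfolding dist_norm by (rule component_le_norm_cart)
  then have "(0::real^2) \<notin> closure hole" by (simp add: hole_def dist_commute)
  then have "0 \<in> Omega"
    using cbox_minus_hole_subset_Omega by (auto simp: mem_box_cart)
  then show ?thesis unfolding Omega_eps_def by force
qed

text \<open>Where \<open>V\<close> vanishes, the Hamiltonian is a square and hence nonnegative for
  every slope. Testing the cell subsolution at one such point therefore bounds \<open>Hb p\<close>
  from below.\<close>

lemma effective_Hamiltonian_nonneg:
  assumes supp: "closure {y. V y \<noteq> 0} \<subseteq> torus_ball (1/4)"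
    and eff: "effective_Hamiltonian Omega (Ham V) Hb"
  shows "0 \<le> Hb p"
proof -
  \<comment> \<open>The centre is (1/2, 1/8). On the ball of radius 1/16 the first coordinate stays
    7/16 away from the integers and the second 5/16 away from 1/2. Both exceed 1/4, so the ball
    misses the support of \<open>V\<close> and the closed hole.\<close>
  define y0 :: "real^2" where "y0 = (\<chi> i. if i = 1 then 1/2 else 1/8)"
  have near: "\<bar>y $ 1 - 1/2\<bar> \<le> 1/16" "\<bar>y $ 2 - 1/8\<bar> \<le> 1/16" if "y \<in> cball y0 (1/16)" for y
  proof -
    have "norm (y - y0) \<le> 1/16" using that by (simp add: dist_norm norm_minus_commute)
    then show "\<bar>y $ 1 - 1/2\<bar> \<le> 1/16" "\<bar>y $ 2 - 1/8\<bar> \<le> 1/16"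
      using component_le_norm_cart[of "y - y0" 1] component_le_norm_cart[of "y - y0" 2]
      by (auto simp: y0_def)
  qed
  have sub: "cball y0 (1/16) \<subseteq> Omega"
  proof
    fix y assume y: "y \<in> cball y0 (1/16)"
    have "\<bar>(y - (\<chi> i. 1/2)) $ 2\<bar> \<le> dist y (\<chi> i. 1/2)"
      unfolding dist_norm by (rule component_le_norm_cart)
    then have "y \<notin> closure hole" using near(2)[OF y] by (auto simp: hole_def dist_commute)
    moreover have "0 \<le> y $ 1" "y $ 1 \<le> 1" "0 \<le> y $ 2" "y $ 2 \<le> 1"
      using near[OF y] by linarith+
    then have "y \<in> cbox 0 (\<chi> i. 1)"
      by (simp add: mem_box_cart forall_2)
    ultimately show "y \<in> Omega"
      using cbox_minus_hole_subset_Omega by blast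
  qed
  have V0: "V y = 0" if y: "y \<in> cball y0 (1/16)" for y
  proof (rule ccontr)
    assume "V y \<noteq> 0"
    then have "y \<in> torus_ball (1/4)" using supp closure_subset by fastforce
    then obtain z where z: "z \<in> Zlat" "dist z y < 1/4" by (auto simp: torus_ball_def)
    obtain k where k: "z $ 1 = of_int k" using z(1) by (auto simp: Zlat_def elim: Ints_cases)
    have "\<bar>of_int k - y $ 1\<bar> < 1/4"
      using component_le_norm_cart[of "z - y" 1] z(2) k by (simp add: dist_norm)
    then have "(0::real) < of_int k" "of_int k < (1::real)" using near(1)[OF y] by linarith+
    then show False by simp
  qed
  obtain v where v: "continuous_on (closure Omega) v"
    and vsub: "visc_sub Omega Omega (\<lambda>y r q. Ham V y (p + q) - Hb p) v"
    using eff unfolding effective_Hamiltonian_def cell_solvable_def by blast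
  have "continuous_on (cball y0 (1/16)) v"
    by (rule continuous_on_subset[OF v order_trans[OF sub closure_subset]])
  then obtain z q where z: "z \<in> ball y0 (1/16)" "touch_above Omega v z q"
    using touch_above_in_ball[of y0 "1/16" v Omega] by auto
  then have "z \<in> cball y0 (1/16)" by simp
  then have "Ham V z (p + q) - Hb p \<le> 0" using vsub z sub unfolding visc_sub_def by blast
  moreover have "0 \<le> Ham V z (p + q)"
    using V0[OF \<open>z \<in> cball y0 (1/16)\<close>] by (simp add: Ham_def)
  ultimately show ?thesis by simp
qed

theorem proposition5p1:
  fixes V Hb :: "real^2 \<Rightarrow> real"
    and \<epsilon> :: real
    and ueps u :: "(real^2) \<times> real \<Rightarrow> real"
  assumes "continuous_on UNIV V" and "Z_periodic_on UNIV V"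
    and "\<And>y. 0 \<le> V y \<and> V y \<le> 1"
    and "\<And>y. y \<in> torus_ball (1/8) \<Longrightarrow> V y = 1"
    and "closure {y. V y \<noteq> 0} \<subseteq> torus_ball (1/4)"
    and "effective_Hamiltonian Omega (Ham V) Hb"
    and "0 < \<epsilon>" and "\<epsilon> < 1"
    and "dirichlet_solution (Omega_eps \<epsilon>) (\<lambda>x p. Ham V ((1/\<epsilon>) *\<^sub>R x) p) (\<lambda>_. 1) (\<lambda>_. 0) ueps"
    and "obstacle_solution Hb (\<lambda>_. 1) (\<lambda>_. 0) u"
  shows "ueps (0, 1) - u (0, 1) \<ge> \<epsilon> / 8"
proof -
  \<comment> \<open>Rescaling by \<open>1/\<epsilon>\<close> turns the ball of radius
    \<open>\<epsilon> / 8\<close> into one where \<open>V\<close> equals 1, and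
    \<open>\<epsilon> < 1\<close> gives the required bound 1/8 on the radius.\<close>
  have "\<epsilon> / 8 \<le> ueps (0, 1)"
  proof (rule dirichlet_solution_lower_bound[OF assms(9)])
    show "Ham V ((1/\<epsilon>) *\<^sub>R x) p \<le> (norm p)\<^sup>2 / 2" for x p
      using assms(3) by (simp add: Ham_def)
    show "Ham V ((1/\<epsilon>) *\<^sub>R x) p \<le> (norm p)\<^sup>2 / 2 - 1" if "x \<in> ball 0 (\<epsilon> / 8)" for x p
    proof -
      have "(1/\<epsilon>) *\<^sub>R x \<in> ball 0 (1/8)" using that assms(7) by (simp add: field_simps)
      then have "(1/\<epsilon>) *\<^sub>R x \<in> torus_ball (1/8)"
        unfolding torus_ball_def using zero_in_Zlat by blast
      then show ?thesis using assms(4) by (simp add: Ham_def)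
    qed
    show "0 \<in> closure (Omega_eps \<epsilon>)" using zero_in_Omega_eps closure_subset by blast
  qed (use assms in auto)
  moreover have "u (0, 1) \<le> 0"
    using obstacle_solution_nonpos[OF assms(10)] effective_Hamiltonian_nonneg[OF assms(5,6)]
    by simp
  ultimately show ?thesis by simp
qed

end
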